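(* There exist absolute constants $c_1, c_2 > 0$ and irreducible reversible Markov chains $(V,P,\pi)$ with $|V|$ arbitrarily large such that \[ \lambda_2(I-P) \le c_1 \frac{\log |V|}{|V|^2} \quad \text{and} \quad \varphi_{\frac12}(P) \ge c_2 \frac{\log |V|}{|V|}. \] Consequently, for these chains $\lambda_2(I-P) \lesssim \dfrac{\big(\varphi_{\frac12}(P)\big)^2}{\log\big(1/\varphi_{\frac12}(P)\big)}$, where $\lesssim$ hides an absolute constant.
   Context: A Markov chain $(V,P,\pi)$ consists of a finite state set $V$, a transition matrix $P \in \mathbb{R}^{V\times V}$ (nonnegative entries, rows summing to $1$) and a stationary distribution $\pi$ ($\pi^T P = \pi^T$); it is irreducible if its transition graph is strongly connected and reversible if $\pi(u)P(u,v) = \pi(v)P(v,u)$ for all $u,v$. For a reversible chain, $I-P$ has real eigenvalues $0=\lambda_1 \le \lambda_2 \le \dots$; $\lambda_2(I-P)$ denotes the second smallest. For $S \subseteq V$ write $\pi(S) = \sum_{v\in S}\pi(v)$, $\overline{S} = V\setminus S$, $P(v,T) = \sum_{u\in T}P(v,u)$. For $p \in (0,1]$ the isoperimetric constant is \[ \varphi_p(P) = \min_{S \subset V,\ S\neq\emptyset,\ \pi(S)\le \frac12} \frac{\sum_{v\in S}\pi(v)\, P(v,\overline{S})^p}{\pi(S)}. \] Logarithms are natural. *)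

theory Defs
  imports
    Complex_Main
    "HOL-Library.Multiset"
    "HOL-Computational_Algebra.Polynomial"
    "Jordan_Normal_Form.Char_Poly"
begin

(* The values of P and \<pi> outside V are irrelevant everywhere below. *)

locale markov_chain =
  fixes V :: "'a set" and P :: "'a \<Rightarrow> 'a \<Rightarrow> real" and \<pi> :: "'a \<Rightarrow> real"
  assumes finite_states: "finite V"
    and trans_nonneg: "\<And>u v. u \<in> V \<Longrightarrow> v \<in> V \<Longrightarrow> 0 \<le> P u v"
    and trans_row_sum: "\<And>u. u \<in> V \<Longrightarrow> (\<Sum>v\<in>V. P u v) = 1"
    and distr_nonneg: "\<And>v. v \<in> V \<Longrightarrow> 0 \<le> \<pi> v"
    and distr_sum: "(\<Sum>v\<in>V. \<pi> v) = 1"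
    and stationary: "\<And>v. v \<in> V \<Longrightarrow> (\<Sum>u\<in>V. \<pi> u * P u v) = \<pi> v"

definition transition_graph :: "'a set \<Rightarrow> ('a \<Rightarrow> 'a \<Rightarrow> real) \<Rightarrow> ('a \<times> 'a) set" where
  "transition_graph V P = {(u, v). u \<in> V \<and> v \<in> V \<and> P u v > 0}"

definition irreducible_chain :: "'a set \<Rightarrow> ('a \<Rightarrow> 'a \<Rightarrow> real) \<Rightarrow> bool" where
  "irreducible_chain V P \<longleftrightarrow> (\<forall>u\<in>V. \<forall>v\<in>V. (u, v) \<in> (transition_graph V P)\<^sup>*)"

definition reversible_chain ::
  "'a set \<Rightarrow> ('a \<Rightarrow> 'a \<Rightarrow> real) \<Rightarrow> ('a \<Rightarrow> real) \<Rightarrow> bool" where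
  "reversible_chain V P \<pi> \<longleftrightarrow> (\<forall>u\<in>V. \<forall>v\<in>V. \<pi> u * P u v = \<pi> v * P v u)"

(* The linear order on states only serves to index rows and columns; the
   characteristic polynomial does not depend on it. *)
definition transition_mat :: "'a::linorder set \<Rightarrow> ('a \<Rightarrow> 'a \<Rightarrow> real) \<Rightarrow> real mat" where
  "transition_mat V P =
     mat (card V) (card V)
       (\<lambda>(i, j). P (sorted_list_of_set V ! i) (sorted_list_of_set V ! j))"

(* Real eigenvalues in increasing order, repeated according to their algebraic multiplicity. *)
definition sorted_eigenvalues :: "real mat \<Rightarrow> real list" where
  "sorted_eigenvalues A = sorted_list_of_multiset (proots (char_poly A))"

(* Lists are indexed from 0. Meaningful if A has at least two real eigenvalues, which holds
   for A = I - P with P reversible and irreducible on at least two states. *)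
definition lambda2 :: "real mat \<Rightarrow> real" where
  "lambda2 A = sorted_eigenvalues A ! 1"

(* The feasible sets S are automatically proper subsets of V, since \<pi>(V) = 1. For an
   irreducible chain on at least two states, feasible sets exist and satisfy \<pi>(S) > 0. *)
definition isoperimetric_const ::
  "real \<Rightarrow> 'a set \<Rightarrow> ('a \<Rightarrow> 'a \<Rightarrow> real) \<Rightarrow> ('a \<Rightarrow> real) \<Rightarrow> real" where
  "isoperimetric_const p V P \<pi> =
     Min {(\<Sum>v\<in>S. \<pi> v * (\<Sum>u\<in>V - S. P v u) powr p) / (\<Sum>v\<in>S. \<pi> v) | S.
            S \<subseteq> V \<and> S \<noteq> {} \<and> (\<Sum>v\<in>S. \<pi> v) \<le> 1 / 2}"

end

theory Submission
  imports Defs "HOL-Number_Theory.Cong"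
begin

text \<open>The chains are random walks on the cycle of length \<open>n\<close> whose jumps of length \<open>d\<close> have probability
  of order \<open>1 / d\<^sup>3\<close>. Constants and \<open>v \<mapsto> cos (2 * pi * v / n)\<close> are eigenvectors; the eigenvalue of the
  latter is at most of order \<open>(\<Sum>d. d\<^sup>2 / d\<^sup>3) / n\<^sup>2\<close>, which is of order \<open>ln n / n\<^sup>2\<close>. For the
  isoperimetric constant, consider windows of length \<open>2 * s\<close> with \<open>s \<le> sqrt n\<close>. If \<open>S\<close> never fills more
  than half of a window that starts in \<open>S\<close>, all its points escape with probability at least of
  order \<open>1 / s\<^sup>2\<close>, and this suffices. Otherwise some window is exactly half full, so \<open>s\<close> points of \<open>S\<close>
  escape with such a probability. If this happens for every \<open>s\<close>, the square roots of the escape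
  probabilities sum up to at least a harmonic sum.\<close>

section \<open>Sums and logarithms\<close>

text \<open>By \<open>ln x \<le> x - 1\<close>, the logarithm grows from m + 1 to m + 2 by at most
  1/(m + 1), the next summand.\<close>

lemma ln_le_sum_inverse: "ln (real m + 1) \<le> (\<Sum>k=1..m. 1 / real k)"
proof (induction m)
  case (Suc m)
  have "ln (real (Suc m) + 1) = ln (real m + 1) + ln ((real m + 2) / (real m + 1))"
    by (simp add: ln_div)
  also have "ln ((real m + 2) / (real m + 1)) \<le> (real m + 2) / (real m + 1) - 1"
    by (intro ln_le_minus_one) simp
  also have "\<dots> = 1 / real (Suc m)"
    by (simp add: field_simps)
  finally show ?case
    using Suc.IH by simp
qed simp

lemma sum_inverse_le_ln:
  assumes "1 \<le> m"
  shows "(\<Sum>k=1..m. 1 / real k) \<le> 1 + ln (real m)"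
  using assms
proof (induction m rule: dec_induct)
  case (step m)
  have "ln (real m / real (Suc m)) \<le> real m / real (Suc m) - 1"
    using step by (intro ln_le_minus_one) simp
  also have "\<dots> = - (1 / real (Suc m))"
    by (simp add: field_simps)
  finally have "1 / real (Suc m) \<le> ln (real (Suc m)) - ln (real m)"
    using step by (simp add: ln_div)
  then show ?case
    using step by simp
qed simp

text \<open>Telescoping: 1/k^3 is at most 1/(k-1) - 1/k for k \<ge> 2. The sum stays below 2, so
  subtracting a quarter of it from 1 leaves a holding probability of at least 1/2.\<close>

lemma sum_inverse_cube_le:
  assumes "1 \<le> m"
  shows "(\<Sum>k=1..m. 1 / real k ^ 3) \<le> 2 - 1 / real m"
  using assms
proof (induction m rule: dec_induct)
  case (step m)
  have "1 / real (Suc m) ^ 3 \<le> 1 / (real m * real (Suc m))"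
  proof (rule divide_left_mono)
    have "real m * real (Suc m) \<le> real (Suc m) * real (Suc m)"
      by (intro mult_right_mono) auto
    also have "\<dots> \<le> real (Suc m) ^ 3"
      using power_increasing[of 2 3 "real (Suc m)"] by (simp add: power2_eq_square)
    finally show "real m * real (Suc m) \<le> real (Suc m) ^ 3" .
  qed (use step in auto)
  also have "\<dots> = 1 / real m - 1 / real (Suc m)"
    using step by (simp add: field_simps)
  finally show ?case
    using step by simp
qed simp

lemma one_minus_cos_le: "1 - cos x \<le> x\<^sup>2 / 2" for x :: real
proof -
  have "1 - cos x = 2 * (sin (x / 2))\<^sup>2"
    using cos_double_sin[of "x / 2"] by simp
  also have "(sin (x / 2))\<^sup>2 \<le> (x / 2)\<^sup>2"
    using abs_sin_x_le_abs_x[of "x / 2"] by (simp only: abs_le_square_iff)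
  finally show ?thesis
    by (simp add: power2_eq_square)
qed

lemma sum_ge_if_superlevel_card_ge:
  fixes h :: "'a \<Rightarrow> real" and t :: "nat \<Rightarrow> real"
  assumes "finite S" and h: "\<And>v. v \<in> S \<Longrightarrow> 0 \<le> h v"
    and lev: "\<And>s. 1 \<le> s \<Longrightarrow> s \<le> m \<Longrightarrow> s \<le> card {v \<in> S. t s \<le> h v}"
  shows "(\<Sum>s=1..m. t s) \<le> sum h S"
proof -
  have "\<exists>A\<subseteq>S. card A = m \<and> (\<Sum>s=1..m. t s) \<le> sum h A"
    using lev
  proof (induction m)
    case (Suc m)
    then obtain A where A: "A \<subseteq> S" "card A = m" "(\<Sum>s=1..m. t s) \<le> sum h A"
      by (meson le_SucI)
    have fA: "finite A"
      using A \<open>finite S\<close> finite_subset by blast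
    have "\<not> {v \<in> S. t (Suc m) \<le> h v} \<subseteq> A"
    proof
      assume "{v \<in> S. t (Suc m) \<le> h v} \<subseteq> A"
      then have "card {v \<in> S. t (Suc m) \<le> h v} \<le> m"
        using card_mono[OF fA] A by metis
      then show False
        using Suc.prems[of "Suc m"] by simp
    qed
    then obtain v where v: "v \<in> S" "t (Suc m) \<le> h v" "v \<notin> A"
      by blast
    show ?case
      by (rule exI[of _ "insert v A"]) (use A v fA in auto)
  qed (auto intro: exI[of _ "{}"])
  then obtain A where "A \<subseteq> S" "(\<Sum>s=1..m. t s) \<le> sum h A"
    by blast
  then show ?thesis
    using sum_mono2[of S A h] \<open>finite S\<close> h by fastforce
qed

section \<open>The second smallest eigenvalue\<close>

lemma sorted_nth_1_le:
  assumes "sorted xs" "x \<in> set xs" "y \<in> set xs" "x < y"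
  shows "xs ! 1 \<le> y"
proof -
  obtain i j where ij: "i < length xs" "xs ! i = x" "j < length xs" "xs ! j = y"
    using assms by (metis in_set_conv_nth)
  \<comment> \<open>Position 0 holds a minimum, which is at most \<open>x\<close> and hence less
    than \<open>y\<close>.\<close>
  have "j \<noteq> 0"
    using ij assms by (metis leD sorted_nth_mono zero_le)
  then show ?thesis
    using ij sorted_nth_mono[OF \<open>sorted xs\<close>, of 1 j] by simp
qed

text \<open>For an upper bound it is enough to exhibit two distinct eigenvalues; the rest of the
  spectrum need not be computed.\<close>

lemma lambda2_le:
  assumes A: "A \<in> carrier_mat n n" and "eigenvalue A x" "eigenvalue A y" "x < y"
  shows "lambda2 A \<le> y"
proof -
  \<comment> \<open>Only for a nonzero polynomial does \<open>proots\<close> list exactly the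
    roots.\<close>
  have "char_poly A \<noteq> 0"
    using degree_monic_char_poly[OF A] by auto
  then have "set_mset (proots (char_poly A)) = {x. eigenvalue A x}"
    by (simp add: eigenvalue_root_char_poly[OF A])
  then show ?thesis
    unfolding lambda2_def sorted_eigenvalues_def using assms
    by (intro sorted_nth_1_le[of _ x]) (auto simp: sorted_sorted_list_of_multiset)
qed

lemma eigenvalue_laplacian:
  assumes eq: "\<And>u. u < n \<Longrightarrow> (\<Sum>v<n. P u v * f v) = (1 - \<mu>) * f u"
    and "w < n" "f w \<noteq> 0"
  shows "eigenvalue (1\<^sub>m n - transition_mat {..<n} P) \<mu>"
proof -
  \<comment> \<open>The sorted list of \<open>{..<n}\<close> has entry i at position i, so states
    are their own indices.\<close>
  have T: "transition_mat {..<n} P = mat n n (\<lambda>(i, j). P i j)"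
    unfolding transition_mat_def by (intro eq_matI) (auto simp: lessThan_atLeast0)
  have "(1\<^sub>m n - mat n n (\<lambda>(i, j). P i j)) *\<^sub>v vec n f = \<mu> \<cdot>\<^sub>v vec n f"
  proof (rule eq_vecI)
    fix u assume "u < dim_vec (\<mu> \<cdot>\<^sub>v vec n f)"
    then have u: "u < n"
      by simp
    have "((1\<^sub>m n - mat n n (\<lambda>(i, j). P i j)) *\<^sub>v vec n f) $ u
        = (\<Sum>v<n. ((if u = v then 1 else 0) - P u v) * f v)"
      using u by (simp add: scalar_prod_def lessThan_atLeast0)
    also have "\<dots> = (\<Sum>v<n. (if u = v then f v else 0)) - (\<Sum>v<n. P u v * f v)"
      unfolding sum_subtractf[symmetric] by (intro sum.cong) (auto simp: algebra_simps)
    also have "\<dots> = \<mu> * f u"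
      unfolding eq[OF u] using u by (simp add: algebra_simps)
    finally show "((1\<^sub>m n - mat n n (\<lambda>(i, j). P i j)) *\<^sub>v vec n f) $ u = (\<mu> \<cdot>\<^sub>v vec n f) $ u"
      using u by simp
  qed simp
  moreover have "vec n f \<noteq> 0\<^sub>v n"
    using assms(2,3) by (metis index_vec index_zero_vec(1))
  ultimately show ?thesis
    unfolding T eigenvalue_def eigenvector_def by (intro exI[of _ "vec n f"]) auto
qed

section \<open>The long-range walk on the cycle\<close>

lemma bij_betw_add_mod: "bij_betw (\<lambda>x. (u + x) mod n) {..<n} {..<n::nat}"
proof -
  have "inj_on (\<lambda>x. (u + x) mod n) {..<n}"
    by (rule inj_onI) (metis cong_add_lcancel_nat cong_def lessThan_iff mod_less)
  moreover have "(\<lambda>x. (u + x) mod n) ` {..<n} \<subseteq> {..<n}"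
    by auto
  ultimately show ?thesis
    by (simp add: bij_betw_def endo_inj_surj)
qed

lemma sum_add_mod: "(\<Sum>x<n. F ((u + x) mod n)) = (\<Sum>x<n::nat. F x)"
  by (rule sum.reindex_bij_betw[OF bij_betw_add_mod])

lemma sum_reflect: "(\<Sum>d=1..<n. F (n - d)) = (\<Sum>d=1..<n::nat. F d)"
  by (rule sum.reindex_bij_witness[of _ "\<lambda>d. n - d" "\<lambda>d. n - d"]) auto

lemma sum_lessThan_split: "0 < n \<Longrightarrow> (\<Sum>d<n::nat. F d) = F 0 + (\<Sum>d=1..<n. F d)"
  by (simp add: lessThan_atLeast0 sum.atLeast_Suc_lessThan)

text \<open>The tail exponent 3 makes the variance of a jump of order \<open>ln n\<close>, while a vertex at
  distance \<open>d\<close> from the end of an arc leaves it with probability of order \<open>1 / d\<^sup>2\<close>. Adding both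
  directions instead of using the cyclic distance makes the symmetry under \<open>d \<mapsto> n - d\<close> evident.\<close>

definition jump_prob :: "nat \<Rightarrow> nat \<Rightarrow> real" where
  "jump_prob n d =
     (if d = 0 then 1 - (\<Sum>k=1..<n. 1 / real k ^ 3) / 4
      else (1 / real d ^ 3 + 1 / real (n - d) ^ 3) / 8)"

text \<open>Adding \<open>n\<close> before subtracting \<open>u\<close> prevents truncation when v <
  u < n.\<close>

definition cycle_walk :: "nat \<Rightarrow> nat \<Rightarrow> nat \<Rightarrow> real" where
  "cycle_walk n u v = jump_prob n ((v + n - u) mod n)"

lemma jump_prob_reflect: "0 < d \<Longrightarrow> d < n \<Longrightarrow> jump_prob n (n - d) = jump_prob n d"
  by (simp add: jump_prob_def)

lemma jump_prob_ge: "0 < d \<Longrightarrow> 1 / (8 * real d ^ 3) \<le> jump_prob n d"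
  by (simp add: jump_prob_def)

text \<open>Reflection swaps the two directions in \<open>jump_prob\<close>, so both contribute
  equally against a symmetric \<open>F\<close>, giving 2/8 = 1/4. Applied to the total mass and to
  the eigenvalue of the cosine.\<close>

lemma sum_jump_prob_mult:
  assumes "\<And>d. 0 < d \<Longrightarrow> d < n \<Longrightarrow> F (n - d) = F d"
  shows "(\<Sum>d=1..<n. jump_prob n d * F d) = (\<Sum>d=1..<n. F d / real d ^ 3) / 4"
proof -
  have "(\<Sum>d=1..<n. jump_prob n d * F d)
      = (\<Sum>d=1..<n. F d / real d ^ 3 / 8) + (\<Sum>d=1..<n. F (n - d) / real (n - d) ^ 3 / 8)"
    unfolding sum.distrib[symmetric]
    by (intro sum.cong) (auto simp: jump_prob_def assms add_divide_distrib algebra_simps)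
  also have "\<dots> = 2 * (\<Sum>d=1..<n. F d / real d ^ 3 / 8)"
    by (subst sum_reflect) simp
  also have "\<dots> = (\<Sum>d=1..<n. F d / real d ^ 3) / 4"
    unfolding sum_divide_distrib[symmetric] by simp
  finally show ?thesis .
qed

lemma sum_jump_prob:
  assumes "0 < n"
  shows "(\<Sum>d<n. jump_prob n d) = 1"
  using sum_jump_prob_mult[of n "\<lambda>_. 1"] assms
  by (simp add: sum_lessThan_split jump_prob_def[of n 0])

lemma jump_prob_0_ge: "1 / 2 \<le> jump_prob n 0"
proof (cases "n \<le> 1")
  case False
  then have "{1..<n} = {1..n - 1}"
    by auto
  then have "(\<Sum>k=1..<n. 1 / real k ^ 3) \<le> 2 - 1 / real (n - 1)"
    using sum_inverse_cube_le[of "n - 1"] False by simp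
  then have "(\<Sum>k=1..<n. 1 / real k ^ 3) \<le> 2"
    by (smt (verit) divide_nonneg_nonneg of_nat_0_le_iff)
  then show ?thesis
    by (simp add: jump_prob_def)
qed (simp add: jump_prob_def)

lemma jump_prob_pos: "0 < jump_prob n d"
proof (cases "d = 0")
  case True
  then show ?thesis
    using jump_prob_0_ge[of n] by simp
next
  case False
  then have "0 < 1 / (8 * real d ^ 3)"
    by simp
  then show ?thesis
    using jump_prob_ge[of d n] False by linarith
qed

section \<open>Symmetry, stationarity and irreducibility of the walk\<close>

lemma cycle_walk_pos: "0 < cycle_walk n u v"
  by (simp add: cycle_walk_def jump_prob_pos)

lemma cycle_walk_shift:
  assumes "u < n" "d < n"
  shows "cycle_walk n u ((u + d) mod n) = jump_prob n d"
proof (cases "u + d < n")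
  case False
  then have "(u + d) mod n = u + d - n"
    using assms by (simp add: le_mod_geq)
  then show ?thesis
    using assms False by (simp add: cycle_walk_def)
qed (use assms in \<open>simp add: cycle_walk_def\<close>)

lemma cycle_walk_sym:
  assumes "u < n" "v < n"
  shows "cycle_walk n u v = cycle_walk n v u"
proof -
  have "cycle_walk n u v = cycle_walk n v u" if "u < v" "v < n" for u v
  proof -
    have "(v + n - u) mod n = v - u"
      using that by (metis Nat.add_diff_assoc2 less_imp_le less_imp_diff_less mod_add_self2 mod_less)
    moreover have "u + n - v = n - (v - u)"
      using that by simp
    then have "(u + n - v) mod n = n - (v - u)"
      using that by simp
    moreover have "jump_prob n (n - (v - u)) = jump_prob n (v - u)"
      using that by (intro jump_prob_reflect) auto
    ultimately show ?thesis
      by (simp only: cycle_walk_def)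
  qed
  then show ?thesis
    using assms by (metis linorder_neqE_nat)
qed

lemma sum_cycle_walk:
  assumes "u < n"
  shows "(\<Sum>v<n. cycle_walk n u v * F v) = (\<Sum>d<n. jump_prob n d * F ((u + d) mod n))"
  unfolding sum_add_mod[of "\<lambda>v. cycle_walk n u v * F v" u n, symmetric]
  by (intro sum.cong) (auto simp: cycle_walk_shift assms)

lemma sum_cycle_walk_1: "u < n \<Longrightarrow> (\<Sum>v<n. cycle_walk n u v) = 1"
  using sum_cycle_walk[of u n "\<lambda>_. 1"] sum_jump_prob[of n] by simp

lemma markov_chain_cycle_walk:
  assumes "0 < n"
  shows "markov_chain {..<n} (cycle_walk n) (\<lambda>_. 1 / real n)"
proof
  fix v assume "v \<in> {..<n}"
  then have "(\<Sum>u<n. cycle_walk n u v) = (\<Sum>u<n. cycle_walk n v u)"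
    by (intro sum.cong) (auto simp: cycle_walk_sym)
  then show "(\<Sum>u<n. 1 / real n * cycle_walk n u v) = 1 / real n"
    using \<open>v \<in> {..<n}\<close> by (simp add: sum_cycle_walk_1 flip: sum_divide_distrib)
qed (use assms in \<open>auto simp: sum_cycle_walk_1 less_imp_le[OF cycle_walk_pos]\<close>)

lemma irreducible_chain_cycle_walk: "irreducible_chain {..<n} (cycle_walk n)"
  unfolding irreducible_chain_def transition_graph_def
  by (auto intro!: r_into_rtrancl simp: cycle_walk_pos)

lemma reversible_chain_cycle_walk: "reversible_chain {..<n} (cycle_walk n) (\<lambda>_. 1 / real n)"
  unfolding reversible_chain_def by (auto simp: cycle_walk_sym)

section \<open>The spectral gap of the walk\<close>

text \<open>The walk acts as a convolution, and the addition formula splits it into a cosine and a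
  sine part. The sine part vanishes, since jumps are symmetric and the sine is odd.\<close>

lemma cycle_walk_cos:
  assumes "u < n"
  shows "(\<Sum>v<n. cycle_walk n u v * cos (2 * pi * real v / real n))
       = (\<Sum>d<n. jump_prob n d * cos (2 * pi * real d / real n)) * cos (2 * pi * real u / real n)"
proof -
  define c s where "c = (\<lambda>k::nat. cos (2 * pi * real k / real n))"
    and "s = (\<lambda>k::nat. sin (2 * pi * real k / real n))"
  have n: "0 < n"
    using assms by simp
  have cs: "c ((u + d) mod n) = c u * c d - s u * s d" for d
  proof -
    \<comment> \<open>Each turn around the cycle shifts the angle by 2 pi, and \<open>q\<close>
      counts the turns.\<close>
    define q where "q = (u + d) div n"
    have "real u + real d = real n * real q + real ((u + d) mod n)"
      unfolding q_def by (metis mult_div_mod_eq of_nat_add of_nat_mult)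
    then have "2 * pi * real u / real n + 2 * pi * real d / real n
        = 2 * pi * real ((u + d) mod n) / real n + 2 * pi * real q"
      using n by (simp add: field_simps) (simp add: algebra_simps flip: distrib_left)
    moreover have "c u * c d - s u * s d = cos (2 * pi * real u / real n + 2 * pi * real d / real n)"
      by (simp add: c_def s_def cos_add)
    moreover have "cos (2 * pi * real ((u + d) mod n) / real n + 2 * pi * real q)
        = cos (2 * pi * real ((u + d) mod n) / real n)"
      by (simp add: cos_add cos_int_2pin[of "int q", simplified] sin_int_2pin[of "int q", simplified])
    ultimately show ?thesis
      by (simp add: c_def)
  qed
  have s_reflect: "s (n - d) = - s d" if "d < n" for d
  proof -
    have "2 * pi * real (n - d) / real n = 2 * pi - 2 * pi * real d / real n"
      using that n by (simp add: of_nat_diff field_simps)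
    then show ?thesis
      by (simp add: s_def sin_diff)
  qed
  have "(\<Sum>d=1..<n. jump_prob n d * s d) = (\<Sum>d=1..<n. jump_prob n (n - d) * s (n - d))"
    by (rule sum_reflect[symmetric])
  also have "\<dots> = - (\<Sum>d=1..<n. jump_prob n d * s d)"
    unfolding sum_negf[symmetric]
    by (intro sum.cong) (auto simp: s_reflect jump_prob_reflect)
  finally have "(\<Sum>d<n. jump_prob n d * s d) = 0"
    using n by (simp add: sum_lessThan_split s_def)
  moreover have "(\<Sum>v<n. cycle_walk n u v * c v)
      = (\<Sum>d<n. jump_prob n d * c d) * c u - s u * (\<Sum>d<n. jump_prob n d * s d)"
    unfolding sum_cycle_walk[OF assms] sum_distrib_left sum_distrib_right sum_subtractf[symmetric]
    by (intro sum.cong) (simp_all only: cs, simp add: algebra_simps)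
  ultimately show ?thesis
    by (simp add: c_def)
qed

lemma lambda2_cycle_walk_le:
  assumes "2 \<le> n"
  shows "lambda2 (1\<^sub>m n - transition_mat {..<n} (cycle_walk n)) \<le> 8 * (1 + ln (real n)) / (real n)\<^sup>2"
proof -
  define c where "c = (\<lambda>k::nat. cos (2 * pi * real k / real n))"
  define \<mu> where "\<mu> = (\<Sum>d=1..<n. jump_prob n d * (1 - c d))"
  have n: "0 < n"
    using assms by simp
  have mu: "1 - \<mu> = (\<Sum>d<n. jump_prob n d * c d)"
    using sum_jump_prob[OF n] n
    by (simp add: sum_lessThan_split \<mu>_def right_diff_distrib sum_subtractf c_def)
  have "eigenvalue (1\<^sub>m n - transition_mat {..<n} (cycle_walk n)) \<mu>"
    by (rule eigenvalue_laplacian[where f = c and w = 0])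
      (use n cycle_walk_cos in \<open>auto simp: mu c_def\<close>)
  moreover have "eigenvalue (1\<^sub>m n - transition_mat {..<n} (cycle_walk n)) 0"
    by (rule eigenvalue_laplacian[where f = "\<lambda>_. 1" and w = 0])
      (use n in \<open>auto simp: sum_cycle_walk_1\<close>)
  \<comment> \<open>This separates \<mu> from the eigenvalue 0 of the constants. The jump of length
    1 alone contributes a positive amount.\<close>
  moreover have "0 < \<mu>"
    unfolding \<mu>_def
  proof (rule sum_pos2[where i = 1])
    have "0 < pi / real n" "pi / real n < pi"
      using assms by (auto simp: field_simps)
    then have "0 < sin (pi / real n)"
      by (intro sin_gt_zero)
    then have "cos (2 * pi * real 1 / real n) < 1"
      using cos_double_sin[of "pi / real n"] by (simp add: mult.assoc)
    then show "0 < jump_prob n 1 * (1 - c 1)"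
      by (simp add: c_def jump_prob_pos)
  qed (use assms in \<open>auto simp: c_def less_imp_le[OF jump_prob_pos]\<close>)
  ultimately have "lambda2 (1\<^sub>m n - transition_mat {..<n} (cycle_walk n)) \<le> \<mu>"
    by (intro lambda2_le[of _ n 0]) (auto simp: transition_mat_def)
  also have "\<mu> = (\<Sum>d=1..<n. (1 - c d) / real d ^ 3) / 4"
    unfolding \<mu>_def
  proof (rule sum_jump_prob_mult)
    fix d assume "0 < d" "d < n"
    then have "2 * pi * real (n - d) / real n = 2 * pi - 2 * pi * real d / real n"
      by (simp add: of_nat_diff field_simps)
    then show "1 - c (n - d) = 1 - c d"
      by (simp add: c_def cos_diff)
  qed
  also have "\<dots> \<le> (\<Sum>d=1..<n. 2 * pi\<^sup>2 / (real n)\<^sup>2 * (1 / real d)) / 4"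
  proof (intro divide_right_mono sum_mono)
    fix d assume d: "d \<in> {1..<n}"
    \<comment> \<open>The quadratic bound turns the weights 1/d^3 into 1/d, whence the harmonic
      sum.\<close>
    have "(1 - c d) / real d ^ 3 \<le> ((2 * pi * real d / real n)\<^sup>2 / 2) / real d ^ 3"
      unfolding c_def by (intro divide_right_mono one_minus_cos_le) simp
    also have "\<dots> = 2 * pi\<^sup>2 / (real n)\<^sup>2 * (1 / real d)"
      using d by (simp add: field_simps power2_eq_square power3_eq_cube)
    finally show "(1 - c d) / real d ^ 3 \<le> 2 * pi\<^sup>2 / (real n)\<^sup>2 * (1 / real d)" .
  qed simp
  also have "\<dots> = pi\<^sup>2 / (2 * (real n)\<^sup>2) * (\<Sum>d=1..<n. 1 / real d)"
    unfolding sum_distrib_left[symmetric] by simp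
  also have "\<dots> \<le> pi\<^sup>2 / (2 * (real n)\<^sup>2) * (\<Sum>d=1..n. 1 / real d)"
    by (intro mult_left_mono sum_mono2) auto
  also have "\<dots> \<le> 4\<^sup>2 / (2 * (real n)\<^sup>2) * (1 + ln (real n))"
    using n pi_less_4 by (intro mult_mono divide_right_mono power_mono sum_inverse_le_ln sum_nonneg) auto
  finally show ?thesis
    by simp
qed

section \<open>The isoperimetric constant of the walk\<close>

text \<open>An arc of \<open>r\<close> vertices. The start \<open>x\<close> is not reduced modulo
  \<open>n\<close>, so that an arc can slide past the vertex n - 1 without a case
  distinction.\<close>

definition window :: "nat \<Rightarrow> nat \<Rightarrow> nat \<Rightarrow> nat set" where
  "window n r x = (\<lambda>i. (x + i) mod n) ` {..<r}"

lemma inj_on_window: "r \<le> n \<Longrightarrow> inj_on (\<lambda>i. (x + i) mod n) {..<r::nat}"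
  using bij_betw_add_mod[of x n] by (meson bij_betw_imp_inj_on inj_on_subset lessThan_subset_iff)

lemma card_window: "r \<le> n \<Longrightarrow> card (window n r x) = r"
  by (simp add: window_def card_image inj_on_window)

lemma finite_window: "finite (window n r x)"
  by (simp add: window_def)

lemma window_subset: "0 < n \<Longrightarrow> window n r x \<subseteq> {..<n}"
  by (auto simp: window_def)

lemma window_periodic: "window n r (x + n) = window n r x"
proof -
  have "(x + n + i) mod n = (x + i) mod n" for i
    by (metis add.assoc add.commute mod_add_self2)
  then show ?thesis
    by (simp add: window_def)
qed

lemma window_subset_Suc: "window n r x \<subseteq> insert (x mod n) (window n r (Suc x))"
proof
  fix y assume "y \<in> window n r x"
  then obtain i where i: "i < r" "y = (x + i) mod n"
    by (auto simp: window_def)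
  show "y \<in> insert (x mod n) (window n r (Suc x))"
  proof (cases i)
    case (Suc j)
    then have "y = (Suc x + j) mod n" "j < r"
      using i by auto
    then show ?thesis
      by (auto simp: window_def)
  qed (use i in simp)
qed

text \<open>Moving one step forward loses at most the starting point.\<close>

lemma card_window_Suc: "card (window n r x \<inter> S) \<le> Suc (card (window n r (Suc x) \<inter> S))"
proof -
  have "card (window n r x \<inter> S) \<le> card (insert (x mod n) (window n r (Suc x) \<inter> S))"
    using window_subset_Suc[of n r x] by (intro card_mono) (auto simp: finite_window)
  also have "\<dots> \<le> Suc (card (window n r (Suc x) \<inter> S))"
    by (simp add: card_insert_le_m1 card_insert_if finite_window)
  finally show ?thesis .
qed

text \<open>Double counting: for each of the \<open>r\<close> offsets, the shifted start runs
  through every vertex once and so meets \<open>S\<close> exactly \<open>card S\<close>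
  times.\<close>

lemma sum_card_window:
  assumes "r \<le> n" "S \<subseteq> {..<n}"
  shows "(\<Sum>x<n. card (window n r x \<inter> S)) = r * card S"
proof -
  define b :: "nat \<Rightarrow> nat" where "b = (\<lambda>y. if y \<in> S then 1 else 0)"
  have b: "card (W \<inter> S) = sum b W" if "finite W" for W
    unfolding b_def sum.inter_restrict[OF that, symmetric] by simp
  have "card (window n r x \<inter> S) = (\<Sum>i<r. b ((x + i) mod n))" for x
    unfolding b[OF finite_window] unfolding window_def sum.reindex[OF inj_on_window[OF assms(1)]]
    by simp
  then have "(\<Sum>x<n. card (window n r x \<inter> S)) = (\<Sum>i<r. \<Sum>x<n. b ((i + x) mod n))"
    by (simp add: sum.swap[of _ "{..<r}"] add.commute)
  also have "\<dots> = (\<Sum>i<r. card ({..<n} \<inter> S))"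
    unfolding sum_add_mod b[OF finite_lessThan] ..
  also have "{..<n} \<inter> S = S"
    using assms by auto
  finally show ?thesis
    by simp
qed

section \<open>Lower bounds for escape probabilities\<close>

lemma cycle_walk_window_ge:
  assumes "r \<le> n" "u \<in> window n r x" "v \<in> window n r x" "u \<noteq> v"
  shows "1 / (8 * real r ^ 3) \<le> cycle_walk n u v"
proof -
  \<comment> \<open>Offsets inside the arc differ by less than \<open>r\<close>. Symmetry of the
    walk covers the opposite order.\<close>
  have *: "1 / (8 * real r ^ 3) \<le> cycle_walk n ((x + i) mod n) ((x + j) mod n)"
    if "i < j" "j < r" for i j
  proof -
    have "((x + i) mod n + (j - i)) mod n = (x + j) mod n"
      using that unfolding mod_add_left_eq by simp
    then have "cycle_walk n ((x + i) mod n) ((x + j) mod n) = jump_prob n (j - i)"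
      using cycle_walk_shift[of "(x + i) mod n" n "j - i"] that assms by simp
    moreover have "1 / (8 * real r ^ 3) \<le> 1 / (8 * real (j - i) ^ 3)"
      using that by (intro divide_left_mono mult_left_mono power_mono) auto
    moreover have "1 / (8 * real (j - i) ^ 3) \<le> jump_prob n (j - i)"
      using that by (intro jump_prob_ge) simp
    ultimately show ?thesis
      by linarith
  qed
  obtain i j where ij: "i < r" "j < r" "u = (x + i) mod n" "v = (x + j) mod n"
    using assms by (auto simp: window_def)
  have "u < n" "v < n"
    using ij assms by auto
  then show ?thesis
    using * ij assms cycle_walk_sym by (metis linorder_neqE_nat)
qed

text \<open>At least \<open>s\<close> points of the arc lie outside \<open>S\<close>, each hit with
  probability at least 1/(64 s^3). Together this is 1/(64 s^2), the square of the bound.\<close>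

lemma escape_window_ge:
  assumes "0 < s" "2 * s \<le> n" "S \<subseteq> {..<n}" "card (window n (2 * s) x \<inter> S) \<le> s"
    "v \<in> window n (2 * s) x \<inter> S"
  shows "1 / (8 * real s) \<le> sqrt (\<Sum>u\<in>{..<n} - S. cycle_walk n v u)"
proof -
  let ?W = "window n (2 * s) x"
  have "card (?W - S) + card (?W \<inter> S) = 2 * s"
    using card_Diff_subset_Int[of ?W S] card_window[OF assms(2), of x] card_mono[of ?W "?W \<inter> S"]
    by (simp add: finite_window)
  then have "s \<le> card (?W - S)"
    using assms by simp
  have "(1 / (8 * real s))\<^sup>2 = real s * (1 / (8 * real (2 * s) ^ 3))"
    using assms by (simp add: field_simps power2_eq_square power3_eq_cube)
  also have "\<dots> \<le> real (card (?W - S)) * (1 / (8 * real (2 * s) ^ 3))"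
    using \<open>s \<le> card (?W - S)\<close> by (intro mult_right_mono) auto
  also have "\<dots> = (\<Sum>u\<in>?W - S. 1 / (8 * real (2 * s) ^ 3))"
    by simp
  also have "\<dots> \<le> (\<Sum>u\<in>?W - S. cycle_walk n v u)"
    using assms by (intro sum_mono cycle_walk_window_ge[of _ _ _ x]) auto
  also have "\<dots> \<le> (\<Sum>u\<in>{..<n} - S. cycle_walk n v u)"
    using assms window_subset[of n "2 * s" x]
    by (intro sum_mono2) (auto simp: less_imp_le[OF cycle_walk_pos])
  finally show ?thesis
    by (rule real_le_rsqrt)
qed

text \<open>Sliding a window of length \<open>2 * s\<close> changes its number of points of \<open>S\<close> by at most one, so
  the count equals \<open>s\<close> somewhere unless it never exceeds \<open>s\<close>.\<close>

lemma escape_superlevel: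
  assumes "0 < s" "2 * s \<le> n" "S \<subseteq> {..<n}" "2 * card S \<le> n"
  defines "A \<equiv> {v \<in> S. 1 / (8 * real s) \<le> sqrt (\<Sum>u\<in>{..<n} - S. cycle_walk n v u)}"
  shows "A = S \<or> s \<le> card A"
proof (cases "\<forall>v\<in>S. card (window n (2 * s) v \<inter> S) \<le> s")
  case True
  have "v \<in> window n (2 * s) v" if "v \<in> S" for v
    using that assms by (auto simp: window_def intro!: image_eqI[of _ _ 0])
  then have "A = S"
    unfolding A_def using escape_window_ge[OF assms(1-3)] True by blast
  then show ?thesis ..
next
  case False
  define g where "g = (\<lambda>x. card (window n (2 * s) x \<inter> S))"
  obtain v where v: "v \<in> S" "s < g v"
    using False by (auto simp: g_def not_le)
  \<comment> \<open>The average of \<open>g\<close> over all starts is 2 s |S| / n, hence at most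
    \<open>s\<close>.\<close>
  have "\<exists>y<n. g y \<le> s"
  proof (rule ccontr)
    assume "\<not> (\<exists>y<n. g y \<le> s)"
    then have "(\<Sum>x<n. Suc s) \<le> (\<Sum>x<n. g x)"
      by (intro sum_mono) (auto simp: not_le Suc_le_eq)
    also have "\<dots> = s * (2 * card S)"
      unfolding g_def using sum_card_window[OF assms(2,3)] by simp
    also have "\<dots> \<le> s * n"
      using assms by (intro mult_left_mono) auto
    finally show False
      using assms by simp
  qed
  then obtain y where y: "y < n" "g y \<le> s"
    by blast
  \<comment> \<open>The first start after \<open>v\<close> with count at most \<open>s\<close>. It
    exists because y + n lies beyond \<open>v\<close> and has the same count as
    \<open>y\<close>.\<close>
  define z where "z = (LEAST z. v < z \<and> g z \<le> s)"
  have "v < y + n \<and> g (y + n) \<le> s"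
    using v y assms by (auto simp: g_def window_periodic)
  then have z: "v < z" "g z \<le> s"
    unfolding z_def by (metis (mono_tags, lifting) LeastI)+
  \<comment> \<open>Minimality of \<open>z\<close>, or the choice of \<open>v\<close>, gives a count
    above \<open>s\<close> one step earlier; as at most one point is lost, the count at
    \<open>z\<close> is exactly \<open>s\<close>.\<close>
  have "s < g (z - 1)"
  proof (cases "z - 1 = v")
    case False
    then have "v < z - 1" "z - 1 < z"
      using z by auto
    then show ?thesis
      using not_less_Least[of "z - 1" "\<lambda>z. v < z \<and> g z \<le> s"] unfolding z_def[symmetric] by auto
  qed (use v in simp)
  moreover have "g (z - 1) \<le> Suc (g z)"
    using card_window_Suc[of n "2 * s" "z - 1" S] z by (simp add: g_def)
  ultimately have "s \<le> g z"
    by simp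
  moreover have "window n (2 * s) z \<inter> S \<subseteq> A"
    using escape_window_ge[OF assms(1-3)] z by (auto simp: A_def g_def)
  moreover have "finite A"
    unfolding A_def using finite_subset[OF assms(3)] by auto
  ultimately have "s \<le> card A"
    unfolding g_def by (meson card_mono le_trans)
  then show ?thesis ..
qed

text \<open>Half-lengths up to M = sqrt n balance the two cases: a uniform bound 1/(8 s) is at least
  1/(8 M), more than enough since ln M \<le> M, while the harmonic sum up to M still yields half of
  ln n.\<close>

lemma sum_escape_ge:
  assumes M: "2 \<le> M" and n: "n = M\<^sup>2" and S: "S \<subseteq> {..<n}" "2 * card S \<le> n"
  shows "ln (real n) / (16 * real n) * real (card S)
    \<le> (\<Sum>v\<in>S. sqrt (\<Sum>u\<in>{..<n} - S. cycle_walk n v u))"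
proof -
  define h where "h = (\<lambda>v. sqrt (\<Sum>u\<in>{..<n} - S. cycle_walk n v u))"
  have fS: "finite S"
    using S finite_subset by blast
  have lnn: "ln (real n) = 2 * ln (real M)"
    using M by (simp add: n ln_realpow)
  have "2 * M \<le> n"
    using M by (simp add: n power2_eq_square)
  then have level: "{v \<in> S. 1 / (8 * real s) \<le> h v} = S \<or> s \<le> card {v \<in> S. 1 / (8 * real s) \<le> h v}"
    if "1 \<le> s" "s \<le> M" for s
    unfolding h_def using that S by (intro escape_superlevel) auto
  show ?thesis
  proof (cases "\<exists>s. 1 \<le> s \<and> s \<le> M \<and> {v \<in> S. 1 / (8 * real s) \<le> h v} = S")
    case True
    then obtain s where s: "1 \<le> s" "s \<le> M" "\<And>v. v \<in> S \<Longrightarrow> 1 / (8 * real s) \<le> h v"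
      by blast
    have "ln (real n) / (16 * real n) = (ln (real M) / real M) * (1 / (8 * real M))"
      unfolding lnn using M by (simp add: n power2_eq_square)
    also have "\<dots> \<le> 1 * (1 / (8 * real M))"
      using M ln_bound[of "real M"] by (intro mult_right_mono) (auto simp: field_simps)
    also have "\<dots> \<le> 1 / (8 * real s)"
      using s by (simp add: field_simps)
    finally have "ln (real n) / (16 * real n) * real (card S) \<le> 1 / (8 * real s) * real (card S)"
      by (intro mult_right_mono) auto
    also have "\<dots> = (\<Sum>v\<in>S. 1 / (8 * real s))"
      by simp
    also have "\<dots> \<le> (\<Sum>v\<in>S. h v)"
      using s by (intro sum_mono) auto
    finally show ?thesis
      by (simp add: h_def)
  next
    case False
    \<comment> \<open>All superlevel sets are large here, which gives a bound independent of |S|; so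
      |S| may be replaced by n.\<close>
    have "ln (real n) / (16 * real n) * real (card S) \<le> ln (real n) / (16 * real n) * real n"
      using S M by (intro mult_left_mono) (auto simp: lnn)
    also have "\<dots> = ln (real M) / 8"
      unfolding lnn using M by (simp add: n)
    also have "\<dots> \<le> ln (real M + 1) / 8"
      using M by (intro divide_right_mono) auto
    also have "\<dots> \<le> (\<Sum>s=1..M. 1 / real s) / 8"
      by (intro divide_right_mono ln_le_sum_inverse) simp
    also have "\<dots> = (\<Sum>s=1..M. 1 / (8 * real s))"
      by (simp add: sum_divide_distrib mult.commute)
    also have "\<dots> \<le> sum h S"
    proof (rule sum_ge_if_superlevel_card_ge[OF fS])
      show "0 \<le> h v" for v
        by (simp add: h_def sum_nonneg less_imp_le[OF cycle_walk_pos])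
    qed (use level False in blast)
    finally show ?thesis
      by (simp add: h_def)
  qed
qed

text \<open>The uniform weights cancel, leaving an average of square roots of escape probabilities.
  The singleton {0} gives \<phi> < 1, which makes ln (1/\<phi>) positive in the final
  comparison.\<close>

lemma isoperimetric_cycle_walk:
  assumes M: "2 \<le> M" and n: "n = M\<^sup>2"
  defines "\<phi> \<equiv> isoperimetric_const (1 / 2) {..<n} (cycle_walk n) (\<lambda>_. 1 / real n)"
  shows "1 / 16 * (ln (real n) / real n) \<le> \<phi>" "\<phi> < 1"
proof -
  define feasible where "feasible = {S. S \<subseteq> {..<n} \<and> S \<noteq> {} \<and> (\<Sum>v\<in>S. 1 / real n) \<le> 1 / 2}"
  define q where "q = (\<lambda>S. (\<Sum>v\<in>S. 1 / real n * (\<Sum>u\<in>{..<n} - S. cycle_walk n v u) powr (1 / 2))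
    / (\<Sum>v\<in>S. 1 / real n))"
  have phi: "\<phi> = Min (q ` feasible)"
    unfolding \<phi>_def isoperimetric_const_def q_def feasible_def
    by (intro arg_cong[of _ _ Min]) auto
  have n2: "2 \<le> n"
    using M self_le_power[of M 2] by (simp add: n)
  have fin: "finite (q ` feasible)"
    by (intro finite_imageI finite_subset[of feasible "Pow {..<n}"]) (auto simp: feasible_def)
  have q: "q S = (\<Sum>v\<in>S. sqrt (\<Sum>u\<in>{..<n} - S. cycle_walk n v u)) / real (card S)" for S
    using n2 by (simp add: q_def powr_half_sqrt sum_nonneg less_imp_le[OF cycle_walk_pos]
        flip: sum_divide_distrib)
  have 0: "{0} \<in> feasible"
    using n2 by (auto simp: feasible_def)
  show "1 / 16 * (ln (real n) / real n) \<le> \<phi>"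
    unfolding phi
  proof (rule Min.boundedI)
    fix a assume "a \<in> q ` feasible"
    then obtain S where S: "S \<subseteq> {..<n}" "S \<noteq> {}" "(\<Sum>v\<in>S. 1 / real n) \<le> 1 / 2" and a: "a = q S"
      by (auto simp: feasible_def)
    have "finite S"
      using S finite_subset by blast
    then have "0 < card S"
      using S by (simp add: card_gt_0_iff)
    moreover have "2 * card S \<le> n"
      using S(3) n2 by (simp add: field_simps)
    ultimately show "1 / 16 * (ln (real n) / real n) \<le> a"
      using sum_escape_ge[OF M n S(1)] by (simp add: a q field_simps)
  qed (use fin 0 in auto)
  have "\<phi> \<le> q {0}"
    unfolding phi using fin 0 by simp
  also have "(\<Sum>u\<in>{..<n} - {0}. cycle_walk n 0 u) = 1 - jump_prob n 0"
    using n2 sum_cycle_walk_1[of 0 n] by (simp add: sum_diff1 cycle_walk_def)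
  then have "q {0} = sqrt (1 - jump_prob n 0)"
    by (simp add: q)
  also have "\<dots> < 1"
    using jump_prob_pos[of n 0] by simp
  finally show "\<phi> < 1" .
qed

section \<open>Square cycle lengths and comparison of the two quantities\<close>

theorem theorem1p4:
  shows "\<exists>c1>0. \<exists>c2>0. \<exists>C>0. \<forall>N::nat.
    \<exists>(V :: nat set) (P :: nat \<Rightarrow> nat \<Rightarrow> real) (\<pi> :: nat \<Rightarrow> real).
      markov_chain V P \<pi> \<and> irreducible_chain V P \<and> reversible_chain V P \<pi> \<and> N \<le> card V \<and>
      lambda2 (1\<^sub>m (card V) - transition_mat V P)
        \<le> c1 * (ln (real (card V)) / (real (card V))\<^sup>2) \<and>
      isoperimetric_const (1 / 2) V P \<pi> \<ge> c2 * (ln (real (card V)) / real (card V)) \<and>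
      lambda2 (1\<^sub>m (card V) - transition_mat V P)
        \<le> C * ((isoperimetric_const (1 / 2) V P \<pi>)\<^sup>2 / ln (1 / isoperimetric_const (1 / 2) V P \<pi>))"
proof -
  have main: "\<exists>(V :: nat set) (P :: nat \<Rightarrow> nat \<Rightarrow> real) (\<pi> :: nat \<Rightarrow> real).
      markov_chain V P \<pi> \<and> irreducible_chain V P \<and> reversible_chain V P \<pi> \<and> N \<le> card V \<and>
      lambda2 (1\<^sub>m (card V) - transition_mat V P)
        \<le> 16 * (ln (real (card V)) / (real (card V))\<^sup>2) \<and>
      isoperimetric_const (1 / 2) V P \<pi> \<ge> (1 / 16) * (ln (real (card V)) / real (card V)) \<and>
      lambda2 (1\<^sub>m (card V) - transition_mat V P)
        \<le> 8192 * ((isoperimetric_const (1 / 2) V P \<pi>)\<^sup>2 / ln (1 / isoperimetric_const (1 / 2) V P \<pi>))"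
    for N :: nat
  proof -
    \<comment> \<open>The summand 4 ensures n \<ge> 16, used for ln n \<ge> 1 and for 1/\<phi> \<le>
      n^2.\<close>
    define M where "M = N + 4"
    define n where "n = M\<^sup>2"
    define \<phi> where "\<phi> = isoperimetric_const (1 / 2) {..<n} (cycle_walk n) (\<lambda>_. 1 / real n)"
    define L where "L = ln (real n)"
    define lam where "lam = lambda2 (1\<^sub>m n - transition_mat {..<n} (cycle_walk n))"
    have "M \<le> n"
      by (simp add: n_def power2_eq_square)
    moreover have "16 \<le> n"
      using power_mono[of 4 M 2] by (simp add: n_def M_def)
    ultimately have n: "N \<le> n" "16 \<le> n"
      by (auto simp: M_def)
    have L: "1 \<le> L"
      unfolding L_def using n exp_le by (subst ln_ge_iff) auto
    have phi: "1 / 16 * (L / real n) \<le> \<phi>" "\<phi> < 1"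
      unfolding \<phi>_def L_def using isoperimetric_cycle_walk[of M n] by (auto simp: n_def M_def)
    have phi_pos: "0 < 1 / 16 * (L / real n)"
      using L n by simp
    have "lam \<le> 8 * (1 + L) / (real n)\<^sup>2"
      unfolding lam_def L_def using n by (intro lambda2_cycle_walk_le) simp
    also have "\<dots> \<le> 8 * (2 * L) / (real n)\<^sup>2"
      using L by (intro divide_right_mono) auto
    finally have lam: "lam \<le> 16 * (L / (real n)\<^sup>2)"
      by simp
    have "1 / \<phi> \<le> 1 / (1 / 16 * (L / real n))"
      using phi phi_pos by (intro frac_le) auto
    also have "\<dots> = 16 * real n / L"
      by simp
    also have "\<dots> \<le> real n * real n / 1"
      using L n by (intro frac_le mult_right_mono) auto
    finally have "ln (1 / \<phi>) \<le> ln (real n * real n)"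
      using phi phi_pos n by (subst ln_le_cancel_iff) auto
    also have "\<dots> = 2 * L"
      using n by (simp add: L_def ln_mult)
    finally have ln_phi: "ln (1 / \<phi>) \<le> 2 * L" .
    have ln_phi_pos: "0 < ln (1 / \<phi>)"
      using phi phi_pos by (intro ln_gt_zero) (simp add: field_simps)
    \<comment> \<open>The constant is 16 * 16^2 * 2: from the eigenvalue bound, the square of the
      isoperimetric bound, and ln (1/\<phi>) \<le> 2 L.\<close>
    have "16 * (L / (real n)\<^sup>2) = 8192 * ((1 / 16 * (L / real n))\<^sup>2 / (2 * L))"
      using L n by (simp add: field_simps power2_eq_square)
    also have "\<dots> \<le> 8192 * (\<phi>\<^sup>2 / ln (1 / \<phi>))"
      using ln_phi ln_phi_pos phi phi_pos by (intro mult_left_mono frac_le power_mono) auto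
    finally have "lam \<le> 8192 * (\<phi>\<^sup>2 / ln (1 / \<phi>))"
      using lam by linarith
    then show ?thesis
      using lam phi n
      by (intro exI[of _ "{..<n}"] exI[of _ "cycle_walk n"] exI[of _ "\<lambda>_. 1 / real n"])
        (simp add: markov_chain_cycle_walk irreducible_chain_cycle_walk reversible_chain_cycle_walk
          lam_def \<phi>_def L_def)
  qed
  show ?thesis
    by (rule exI[of _ 16], rule conjI, simp, rule exI[of _ "1 / 16"], rule conjI, simp,
        rule exI[of _ 8192], rule conjI, simp) (use main in blast)
qed

end
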